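(* Let $x\in\mathbb{C}$, and let $\mathbf{f}=\{\mathbf{f}_n\}_{n=0}^\infty$ and $\mathbf{g}=\{\mathbf{g}_n\}_{n=0}^\infty$ be two sequences of biquaternions. Define their convolution $\mathbf{w}=\mathbf{f}*\mathbf{g}$ by $$\mathbf{w}_n=(\mathbf{f}*\mathbf{g})_n=\sum_{k=0}^n\mathbf{f}_{n-k}\mathbf{g}_k=\sum_{k=0}^n\mathbf{f}_k\mathbf{g}_{n-k},\qquad n=0,1,2,\dots.$$ Suppose that the Z transform $\mathcal{X}[\mathbf{f}](x)$ converges for $|x|>\sigma_f$ and that $\mathcal{X}[\mathbf{g}](x)$ converges for $|x|>\sigma_g$, where $x$ is complex valued. Then the convolution $\mathbf{w}$ of $\mathbf{f}$ and $\mathbf{g}$ has a Z transform in $|x|>\max(\sigma_f,\sigma_g)$, and there $$\mathcal{X}[\mathbf{w}](x)=\mathcal{X}[\mathbf{f}](x)\,\mathcal{X}[\mathbf{g}](x).$$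
   Context: Biquaternions: $\mathbb{H(C)}$ is the set of $\mathbf{q}=q_0+q_1\mathbf{i}+q_2\mathbf{j}+q_3\mathbf{k}$ with $q_0,\dots,q_3\in\mathbb{C}$, with Hamilton's rules $\mathbf{i}^2=\mathbf{j}^2=\mathbf{k}^2=\mathbf{i}\mathbf{j}\mathbf{k}=-1$; the complex unit, denoted $I$, commutes with $\mathbf{i},\mathbf{j},\mathbf{k}$. The quaternion conjugate is $\overline{\mathbf{q}}=q_0-q_1\mathbf{i}-q_2\mathbf{j}-q_3\mathbf{k}$, and $\|\mathbf{q}\|_{\mathbb{C}}^2:=\mathbf{q}\overline{\mathbf{q}}=q_0^2+q_1^2+q_2^2+q_3^2\in\mathbb{C}$. The real-valued norm $\|\mathbf{q}\|\ge 0$ is defined by $\|\mathbf{q}\|^4=\bigl|\|\mathbf{q}\|_{\mathbb{C}}^2\bigr|^2$; it satisfies $\|\mathbf{p}\mathbf{q}\|=\|\mathbf{p}\|\|\mathbf{q}\|$, and $\|x\|=|x|$ for $x\in\mathbb{C}$. Convergence: a sequence $\mathbf{f}_n\in\mathbb{H(C)}$ has limit $\mathbf{f}\in\mathbb{H(C)}$ if for every $\varepsilon>0$ there is a positive integer $n_0$ with $\|\mathbf{f}_n-\mathbf{f}\|<\varepsilon$ whenever $n>n_0$. A series $\sum_{n=0}^\infty\mathbf{f}_n$ converges to $\mathbf{S}$ if its partial sums $\sum_{n=0}^N\mathbf{f}_n$ converge to $\mathbf{S}$. Z transform (complex variable): for $\mathbf{f}=\{\mathbf{f}_n\}_{n=0}^\infty$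 with $\mathbf{f}_n\in\mathbb{H(C)}$ and $x\in\mathbb{C}$, $\mathcal{X}[\mathbf{f}](x):=\sum_{n=0}^\infty\mathbf{f}_nx^{-n}$. The number $\sigma_f$ ($0\le\sigma_f<\infty$) is the radius of convergence of the Z transform of $\mathbf{f}$: the series converges for $|x|>\sigma_f$ and diverges for $|x|<\sigma_f$.
   Formalization: Convergence of a series of biquaternions means convergence of the four complex coordinates (which implies convergence in ‖·‖); with ‖·‖ alone, which vanishes on zero divisors, limits are not unique and the claim fails. *)

theory Defs
  imports Complex_Main
begin

datatype biquat = Biquat (qre: complex) (qi: complex) (qj: complex) (qk: complex)

lemma biquat_eqI:
  "qre p = qre q \<Longrightarrow> qi p = qi q \<Longrightarrow> qj p = qj q \<Longrightarrow> qk p = qk q \<Longrightarrow> p = q"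
  by (cases p; cases q) simp

instantiation biquat :: ring_1
begin

definition "0 = Biquat 0 0 0 0"
definition "1 = Biquat 1 0 0 0"
definition "p + q = Biquat (qre p + qre q) (qi p + qi q) (qj p + qj q) (qk p + qk q)"
definition "p - q = Biquat (qre p - qre q) (qi p - qi q) (qj p - qj q) (qk p - qk q)"
definition "- q = Biquat (- qre q) (- qi q) (- qj q) (- qk q)"
definition "p * q = Biquat
  (qre p * qre q - qi p * qi q - qj p * qj q - qk p * qk q)
  (qre p * qi q + qi p * qre q + qj p * qk q - qk p * qj q)
  (qre p * qj q - qi p * qk q + qj p * qre q + qk p * qi q)
  (qre p * qk q + qi p * qj q - qj p * qi q + qk p * qre q)"

instance
  by standard
    (simp_all add: zero_biquat_def one_biquat_def plus_biquat_def minus_biquat_def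
      uminus_biquat_def times_biquat_def algebra_simps)

end

lemma biquat_sel_simps [simp]:
  "qre 0 = 0" "qi 0 = 0" "qj 0 = 0" "qk 0 = 0"
  "qre 1 = 1" "qi 1 = 0" "qj 1 = 0" "qk 1 = 0"
  "qre (p + q) = qre p + qre q" "qi (p + q) = qi p + qi q"
  "qj (p + q) = qj p + qj q" "qk (p + q) = qk p + qk q"
  "qre (p - q) = qre p - qre q" "qi (p - q) = qi p - qi q"
  "qj (p - q) = qj p - qj q" "qk (p - q) = qk p - qk q"
  "qre (- q) = - qre q" "qi (- q) = - qi q" "qj (- q) = - qj q" "qk (- q) = - qk q"
  by (simp_all add: zero_biquat_def one_biquat_def plus_biquat_def minus_biquat_def
      uminus_biquat_def)

lemma Hamilton_rules:
  defines "i \<equiv> Biquat 0 1 0 0" and "j \<equiv> Biquat 0 0 1 0" and "k \<equiv> Biquat 0 0 0 1"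
  shows "i * i = - 1" "j * j = - 1" "k * k = - 1" "i * j * k = - 1"
  by (simp_all add: i_def j_def k_def times_biquat_def uminus_biquat_def)

definition of_complex :: "complex \<Rightarrow> biquat" where
  "of_complex c = Biquat c 0 0 0"

definition qcnj :: "biquat \<Rightarrow> biquat" where
  "qcnj q = Biquat (qre q) (- qi q) (- qj q) (- qk q)"

definition cnorm2 :: "biquat \<Rightarrow> complex" where
  "cnorm2 q = (qre q)\<^sup>2 + (qi q)\<^sup>2 + (qj q)\<^sup>2 + (qk q)\<^sup>2"

lemma mult_qcnj: "q * qcnj q = of_complex (cnorm2 q)"
  by (simp add: times_biquat_def qcnj_def of_complex_def cnorm2_def power2_eq_square)

definition qnorm :: "biquat \<Rightarrow> real" where
  "qnorm q = root 4 ((cmod (cnorm2 q))\<^sup>2)"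

lemma qnorm_power4: "qnorm q ^ 4 = (cmod (cnorm2 q))\<^sup>2"
  by (simp add: qnorm_def)

definition qnorm_limit :: "(nat \<Rightarrow> biquat) \<Rightarrow> biquat \<Rightarrow> bool" where
  "qnorm_limit F L \<longleftrightarrow> (\<forall>\<epsilon>>0. \<exists>n0>0. \<forall>n>n0. qnorm (F n - L) < \<epsilon>)"

text \<open>
  \<^term>\<open>qnorm\<close> is multiplicative, but it is not a norm: it vanishes on every zero
  divisor and violates the triangle inequality.  A limit with respect to \<^term>\<open>qnorm\<close> alone is
  therefore not determined by the sequence, and does not give a series a well-defined sum.
\<close>

lemma qnorm_limit_not_unique:
  "qnorm_limit (\<lambda>_. 0) 0" "qnorm_limit (\<lambda>_. 0) (Biquat 1 \<i> 0 0)"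
  by (auto simp: qnorm_limit_def qnorm_def cnorm2_def)

text \<open>
  Limits are thus taken in the sense of \<^term>\<open>qnorm_limit\<close> and, in addition, in the four complex
  coordinates; the latter requirement makes limits unique.  It also cannot be dropped from the
  hypotheses of the convolution theorem: let e be the idempotent \<open>(1 + I i) / 2\<close>, and let
  \<open>f\<^sub>0 = g\<^sub>0 = e\<close>, \<open>f\<^sub>n = 2\<^sup>n j e\<close> and \<open>g\<^sub>n = 2\<^sup>n e j\<close> for \<open>n \<ge> 1\<close>.  All partial sums of the two
  Z transforms are zero divisors, hence have \<^term>\<open>qnorm_limit\<close> 0 for every nonzero x, but the
  partial sums of the Z transform of the convolution have no \<^term>\<open>qnorm_limit\<close> at x = 1.
\<close>

definition biquat_limit :: "(nat \<Rightarrow> biquat) \<Rightarrow> biquat \<Rightarrow> bool" where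
  "biquat_limit F L \<longleftrightarrow> qnorm_limit F L \<and>
     (\<lambda>n. qre (F n)) \<longlonglongrightarrow> qre L \<and> (\<lambda>n. qi (F n)) \<longlonglongrightarrow> qi L \<and>
     (\<lambda>n. qj (F n)) \<longlonglongrightarrow> qj L \<and> (\<lambda>n. qk (F n)) \<longlonglongrightarrow> qk L"

lemma biquat_limit_unique: "biquat_limit F L \<Longrightarrow> biquat_limit F L' \<Longrightarrow> L = L'"
  unfolding biquat_limit_def by (blast intro: biquat_eqI LIMSEQ_unique)

lemma coordinatewise_imp_qnorm_limit:
  assumes "(\<lambda>n. qre (F n)) \<longlonglongrightarrow> qre L" "(\<lambda>n. qi (F n)) \<longlonglongrightarrow> qi L"
    and "(\<lambda>n. qj (F n)) \<longlonglongrightarrow> qj L" "(\<lambda>n. qk (F n)) \<longlonglongrightarrow> qk L"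
  shows "qnorm_limit F L"
proof -
  have "(\<lambda>n. qnorm (F n - L)) \<longlonglongrightarrow> root 4 ((cmod ((qre L - qre L)\<^sup>2 + (qi L - qi L)\<^sup>2
      + (qj L - qj L)\<^sup>2 + (qk L - qk L)\<^sup>2))\<^sup>2)"
    unfolding qnorm_def cnorm2_def biquat_sel_simps by (intro tendsto_intros assms)
  then have lim: "(\<lambda>n. qnorm (F n - L)) \<longlonglongrightarrow> 0"
    by simp
  show ?thesis
    unfolding qnorm_limit_def
  proof (intro allI impI)
    fix \<epsilon> :: real
    assume "\<epsilon> > 0"
    then obtain N where "\<forall>n\<ge>N. qnorm (F n - L) < \<epsilon>"
      using order_tendstoD(2)[OF lim] by (auto simp: eventually_sequentially)
    then show "\<exists>n0>0. \<forall>n>n0. qnorm (F n - L) < \<epsilon>"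
      by (intro exI[of _ "Suc N"]) auto
  qed
qed

definition ztrans_has_sum :: "(nat \<Rightarrow> biquat) \<Rightarrow> complex \<Rightarrow> biquat \<Rightarrow> bool" where
  "ztrans_has_sum f x S \<longleftrightarrow>
     biquat_limit (\<lambda>N. \<Sum>n\<le>N. f n * of_complex (x powi (- int n))) S"

definition ztrans_converges :: "(nat \<Rightarrow> biquat) \<Rightarrow> complex \<Rightarrow> bool" where
  "ztrans_converges f x \<longleftrightarrow> (\<exists>S. ztrans_has_sum f x S)"

definition ztrans :: "(nat \<Rightarrow> biquat) \<Rightarrow> complex \<Rightarrow> biquat" where
  "ztrans f x = (THE S. ztrans_has_sum f x S)"

lemma ztrans_eqI: "ztrans_has_sum f x S \<Longrightarrow> ztrans f x = S"
  unfolding ztrans_def ztrans_has_sum_def by (blast intro: biquat_limit_unique)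

definition convolution :: "(nat \<Rightarrow> biquat) \<Rightarrow> (nat \<Rightarrow> biquat) \<Rightarrow> nat \<Rightarrow> biquat" where
  "convolution f g n = (\<Sum>k\<le>n. f (n - k) * g k)"

lemma convolution_alt: "convolution f g n = (\<Sum>k\<le>n. f k * g (n - k))"
  unfolding convolution_def
  by (rule sum.reindex_bij_witness[of _ "\<lambda>k. n - k" "\<lambda>k. n - k"]) auto

end

theory Submission
  imports Defs
begin

text \<open>
  In each of the four complex coordinates the Z transform is a power series in \<open>1/x\<close>.  A power
  series converges absolutely strictly inside its disc of convergence, so Mertens' theorem on
  Cauchy products applies to every pair of coordinates, and the coordinates of a biquaternion
  product are signed sums of four such products.
\<close>

lemma biquat_sel_times:
  "qre (p * q) = qre p * qre q - qi p * qi q - qj p * qj q - qk p * qk q"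
  "qi (p * q) = qre p * qi q + qi p * qre q + qj p * qk q - qk p * qj q"
  "qj (p * q) = qre p * qj q - qi p * qk q + qj p * qre q + qk p * qi q"
  "qk (p * q) = qre p * qk q + qi p * qj q - qj p * qi q + qk p * qre q"
  by (simp_all add: times_biquat_def)

lemma biquat_sel_times_of_complex:
  "qre (p * of_complex c) = qre p * c" "qi (p * of_complex c) = qi p * c"
  "qj (p * of_complex c) = qj p * c" "qk (p * of_complex c) = qk p * c"
  by (simp_all add: times_biquat_def of_complex_def)

lemma biquat_sel_sum:
  "qre (\<Sum>x\<in>A. F x) = (\<Sum>x\<in>A. qre (F x))" "qi (\<Sum>x\<in>A. F x) = (\<Sum>x\<in>A. qi (F x))"
  "qj (\<Sum>x\<in>A. F x) = (\<Sum>x\<in>A. qj (F x))" "qk (\<Sum>x\<in>A. F x) = (\<Sum>x\<in>A. qk (F x))"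
  by (induction A rule: infinite_finite_induct; simp)+

lemma biquat_limit_iff:
  "biquat_limit F L \<longleftrightarrow>
     (\<lambda>n. qre (F n)) \<longlonglongrightarrow> qre L \<and> (\<lambda>n. qi (F n)) \<longlonglongrightarrow> qi L \<and>
     (\<lambda>n. qj (F n)) \<longlonglongrightarrow> qj L \<and> (\<lambda>n. qk (F n)) \<longlonglongrightarrow> qk L"
  unfolding biquat_limit_def using coordinatewise_imp_qnorm_limit by blast

text \<open>Right multiplication by a complex scalar acts on each coordinate separately, so the
  biquaternion series splits into four complex power series in \<open>inverse x\<close>. The case
  \<open>x = 0\<close> is covered, since \<open>inverse 0 = 0\<close> and
  \<open>0 ^ 0 = 1\<close>.\<close>

lemma ztrans_has_sum_iff:
  "ztrans_has_sum f x S \<longleftrightarrow>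
     (\<lambda>n. qre (f n) * inverse x ^ n) sums qre S \<and> (\<lambda>n. qi (f n) * inverse x ^ n) sums qi S \<and>
     (\<lambda>n. qj (f n) * inverse x ^ n) sums qj S \<and> (\<lambda>n. qk (f n) * inverse x ^ n) sums qk S"
  by (simp add: ztrans_has_sum_def biquat_limit_iff biquat_sel_sum biquat_sel_times_of_complex
      sums_def_le power_int_minus power_inverse)

text \<open>Abel's lemma at the point \<open>inverse y\<close>, which lies farther from 0 than
  \<open>inverse x\<close>. The condition \<open>y \<noteq> 0\<close> matters: as
  \<open>inverse 0 = 0\<close>, every such series converges at \<open>y = 0\<close>.\<close>

lemma ztrans_converges_imp_abs_summable:
  assumes "ztrans_converges f y" and "y \<noteq> 0" and "cmod y < cmod x"
    and c: "c \<in> {qre, qi, qj, qk}"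
  shows "summable (\<lambda>n. norm (c (f n) * inverse x ^ n))"
proof (rule powser_insidea)
  show "norm (inverse x) < norm (inverse y)"
    using assms(2,3) by (simp add: norm_inverse less_imp_inverse_less)
  obtain S where "ztrans_has_sum f y S"
    using assms(1) unfolding ztrans_converges_def by blast
  then have "(\<lambda>n. c (f n) * inverse y ^ n) sums c S"
    using c unfolding ztrans_has_sum_iff by blast
  then show "summable (\<lambda>n. c (f n) * inverse y ^ n)"
    by (rule sums_summable)
qed

text \<open>Since \<open>z ^ k * z ^ (n - k) = z ^ n\<close>, the Cauchy product of two power series
  is again a power series.\<close>

lemma Cauchy_product_powser_sums:
  fixes a b :: "nat \<Rightarrow> 'a::{real_normed_field,banach}"
  assumes "summable (\<lambda>n. norm (a n * z ^ n))" and "summable (\<lambda>n. norm (b n * z ^ n))"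
    and "(\<lambda>n. a n * z ^ n) sums s" and "(\<lambda>n. b n * z ^ n) sums t"
  shows "(\<lambda>n. (\<Sum>k\<le>n. a k * b (n - k)) * z ^ n) sums (s * t)"
proof -
  have "(a k * z ^ k) * (b (n - k) * z ^ (n - k)) = a k * b (n - k) * z ^ n" if "k \<le> n" for k n
    using that by (simp add: mult_ac flip: power_add)
  then have "(\<Sum>k\<le>n. (a k * z ^ k) * (b (n - k) * z ^ (n - k))) =
      (\<Sum>k\<le>n. a k * b (n - k)) * z ^ n" for n
    unfolding sum_distrib_right by (intro sum.cong) auto
  then show ?thesis
    using Cauchy_product_sums[OF assms(1,2)] assms(3,4) by (simp add: sums_iff)
qed

lemma ztrans_has_sum_convolution:
  assumes f: "ztrans_converges f y" and g: "ztrans_converges g y"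
    and y: "y \<noteq> 0" "cmod y < cmod x"
    and S: "ztrans_has_sum f x S" and T: "ztrans_has_sum g x T"
  shows "ztrans_has_sum (convolution f g) x (S * T)"
proof -
  have prod: "(\<lambda>n. (\<Sum>k\<le>n. c (f k) * d (g (n - k))) * inverse x ^ n) sums (c S * d T)"
    if "c \<in> {qre, qi, qj, qk}" "d \<in> {qre, qi, qj, qk}" for c d
  proof (rule Cauchy_product_powser_sums)
    show "summable (\<lambda>n. norm (c (f n) * inverse x ^ n))"
      by (rule ztrans_converges_imp_abs_summable[OF f y that(1)])
    show "summable (\<lambda>n. norm (d (g n) * inverse x ^ n))"
      by (rule ztrans_converges_imp_abs_summable[OF g y that(2)])
    show "(\<lambda>n. c (f n) * inverse x ^ n) sums c S" "(\<lambda>n. d (g n) * inverse x ^ n) sums d T"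
      using that S T unfolding ztrans_has_sum_iff by blast+
  qed
  show ?thesis
    \<comment> \<open>\<open>convolution_alt\<close> gives the left factor the index k, as in
      \<open>prod\<close>. Distributing the sums over the signed products leaves four instances of
      \<open>prod\<close> per coordinate.\<close>
    unfolding ztrans_has_sum_iff convolution_alt biquat_sel_sum biquat_sel_times
      sum.distrib sum_subtractf distrib_right left_diff_distrib
    by (intro conjI; intro sums_add sums_diff) (rule prod; simp)+
qed

theorem theorem3p2:
  fixes f g :: "nat \<Rightarrow> biquat" and \<sigma>\<^sub>f \<sigma>\<^sub>g :: real
  assumes "0 \<le> \<sigma>\<^sub>f" and "0 \<le> \<sigma>\<^sub>g"
    and "\<forall>x. cmod x > \<sigma>\<^sub>f \<longrightarrow> ztrans_converges f x"
    and "\<forall>x. cmod x > \<sigma>\<^sub>g \<longrightarrow> ztrans_converges g x"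
  shows "\<forall>x. cmod x > max \<sigma>\<^sub>f \<sigma>\<^sub>g \<longrightarrow>
           ztrans_converges (convolution f g) x \<and>
           ztrans (convolution f g) x = ztrans f x * ztrans g x"
proof (intro allI impI)
  fix x
  assume x: "cmod x > max \<sigma>\<^sub>f \<sigma>\<^sub>g"
  \<comment> \<open>A radius strictly in between leaves room for a point y closer to 0 than x at
    which both transforms still converge.\<close>
  then obtain r where r: "max \<sigma>\<^sub>f \<sigma>\<^sub>g < r" "r < cmod x"
    using dense by blast
  define y where "y = complex_of_real r"
  \<comment> \<open>Here r is positive because \<open>\<sigma>\<^sub>f\<close> is
    nonnegative.\<close>
  have y: "cmod y = r" "y \<noteq> 0"
    using r(1) assms(1) by (auto simp: y_def)
  obtain S T where S: "ztrans_has_sum f x S" and T: "ztrans_has_sum g x T"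
    using assms(3,4) x unfolding ztrans_converges_def by fastforce
  have "ztrans_has_sum (convolution f g) x (S * T)"
    using assms(3,4) r y by (intro ztrans_has_sum_convolution[OF _ _ _ _ S T, of y]) auto
  \<comment> \<open>\<open>ztrans\<close> is a definite description; uniqueness of limits identifies
    its three values with \<open>S * T\<close>, S and T.\<close>
  then show "ztrans_converges (convolution f g) x \<and>
      ztrans (convolution f g) x = ztrans f x * ztrans g x"
    using S T by (auto simp: ztrans_converges_def ztrans_eqI)
qed

end
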